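(* Let $a,b$ be nonnegative integers and let $p>2$ be a prime such that $p\nmid b^2-4a^2$ and $T^{a,b}_n\not\equiv0\pmod p$ for all $0\le n<p$. Let $n\ge0$ be an integer. All congruences are modulo $p$. (i) If $(n)_p=q\,n_0$ with last digit $n_0<p-2$, then $M^{a,b}_n\equiv0$ if and only if $M^{a,b}_{n_0}\equiv0$. (ii) If $(n)_p=q\,m\,(p-1)^k\,(p-2)$ with $q$ a word, $m$ a digit with $0\le m<p-1$, and $k\ge0$, then $M^{a,b}_n\equiv0$ if and only if $bT^{a,b}_m\equiv(T^{a,b}_{p-1})^{k+1}T^{a,b}_{m+1}$. (iii) If $(n)_p=q\,m\,(p-1)^k\,(p-1)$ with $q$ a word, $m$ a digit with $0\le m<p-1$, and $k\ge0$, then, with $\ell=p-2-m$, $M^{a,b}_n\equiv0$ if and only if $bT^{a,b}_\ell\equiv(T^{a,b}_{p-1})^{k+1}T^{a,b}_{\ell+1}$. Note that $0\le m<p-1$ implies $0\le\ell<p-1$ as well. In particular, when $a=b=1$ (with $M_n=M^{1,1}_n$, $T_n=T^{1,1}_n$), if $p>2$ is a prime such that $p\nmid -3$ (i.e. $p\neq3$) and $T_j\not\equiv0\pmod p$ for all $0\le j<p$, and $n\ge0$ is an integer, then: if $(n)_p=q\,n_0$ with last digit $n_0<p-2$, $M_n\equiv0$ iff $M_{n_0}\equiv0$; if $(n)_p=q\,m\,(p-1)^k\,(p-2)$ with $q$ a word, $m$ a digit with $0\le m<p-1$, and $k\ge0$, $M_n\equiv0$ iff $T_m\equiv T_{p-1}^{k+1}T_{m+1}$;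 if $(n)_p=q\,m\,(p-1)^k\,(p-1)$ with $q$ a word, $m$ a digit with $0\le m<p-1$, and $k\ge0$, then, with $\ell=p-2-m$, $M_n\equiv0$ iff $T_\ell\equiv T_{p-1}^{k+1}T_{\ell+1}$.
   Context: For a Laurent polynomial $Q(x)$, $\mathrm{ct}[Q(x)]$ denotes its constant term (the coefficient of $x^0$). For nonnegative integers $a,b$ and $n\ge0$: $T^{a,b}_n=\mathrm{ct}\left[(ax^{-1}+b+ax)^n\right]$ (generalized central trinomial coefficients) and $M^{a,b}_n=\mathrm{ct}\left[(ax^{-1}+b+ax)^n(1-x^2)\right]$ (generalized Motzkin numbers). For $n\ge0$, $(n)_p$ is the word of base-$p$ digits of $n$, most significant digit first, and words may be padded with arbitrarily many leading zeros. Juxtaposition of words and digits is concatenation; $q$ denotes an arbitrary (possibly empty) word over the digits $\{0,\dots,p-1\}$, and $(p-1)^k$ denotes $k$ consecutive copies of the digit $p-1$.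
   Formalization: Parts (ii) and (iii) for general a, b additionally assume that p does not divide a; when p divides a they are false (e.g. a=0, b=1, p=3, n=1: the right-hand congruence holds but M_1=1 is nonzero mod 3). *)

theory Defs
  imports "HOL-Computational_Algebra.Computational_Algebra" "HOL-Number_Theory.Number_Theory"
begin

text \<open>
  Laurent polynomials over the integers are represented inside the ring of formal Laurent series;
  the constant term is the coefficient of index 0.
\<close>

definition ct :: "int fls \<Rightarrow> int" where
  "ct Q = fls_nth Q 0"

definition trinom :: "nat \<Rightarrow> nat \<Rightarrow> int fls" where
  "trinom a b = of_nat a * fls_X_inv + of_nat b + of_nat a * fls_X"

definition T :: "nat \<Rightarrow> nat \<Rightarrow> nat \<Rightarrow> int" where
  "T a b n = ct (trinom a b ^ n)"

definition M :: "nat \<Rightarrow> nat \<Rightarrow> nat \<Rightarrow> int" where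
  "M a b n = ct (trinom a b ^ n * (1 - fls_X ^ 2))"

text \<open>
  \<open>base_word p n w\<close>: the list \<open>w\<close>, most significant digit first and possibly with leading zeros,
  is the word of base-\<open>p\<close> digits of \<open>n\<close>. (The function \<^const>\<open>horner_sum\<close> reads the least
  significant digit first.)
\<close>

definition base_word :: "nat \<Rightarrow> nat \<Rightarrow> nat list \<Rightarrow> bool" where
  "base_word p n w \<longleftrightarrow> (\<forall>d\<in>set w. d < p) \<and> n = horner_sum id p (rev w)"

text \<open>
  If a prime \<open>p\<close> divides \<open>a\<close> but not \<open>b\<close>, then \<open>T a b n\<close> and \<open>M a b n\<close> are both congruent to \<open>b ^ n\<close>
  modulo \<open>p\<close>. Then \<open>M a b n\<close> is never 0 modulo \<open>p\<close>, whereas both sides of the congruences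
  \<open>b T(m) = T(p-1)^(k+1) T(m+1)\<close> are congruent to \<open>b ^ (m+1)\<close>. The criteria for last digit
  \<open>p - 2\<close> or \<open>p - 1\<close> therefore need \<open>p\<close> not to divide \<open>a\<close>; the one for a smaller last digit does not.
\<close>

end

theory Submission
  imports Defs
begin

text \<open>
  Write \<open>D = b\<^sup>2 - 4 a\<^sup>2\<close>. Comparing coefficients in \<open>trinom a b ^ (n + 1)\<close> and in its
  derivative gives
    \<open>2 a\<^sup>2 (n + 1) M(n) = T(n + 2) - b T(n + 1)\<close> and
    \<open>2 a\<^sup>2 (n + 2) M(n) = b T(n + 1) - D T(n)\<close>.
  For last digit \<open>p - 2\<close> the factor \<open>n + 1\<close> is a unit modulo \<open>p\<close>, for last digit \<open>p - 1\<close> the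
  factor \<open>n + 2\<close> is, and the Lucas congruence \<open>T(p n + r) \<equiv> T(n) T(r)\<close> evaluates the right-hand
  sides digit by digit. Eliminating \<open>M\<close> leaves a three-term recurrence for \<open>T\<close>, which yields the
  reflection \<open>D\<^sup>n T(p - 1 - n) \<equiv> T(p - 1) T(n)\<close> for \<open>n < p\<close>; in particular
  \<open>T(p - 1)\<^sup>2 \<equiv> 1\<close>, and \<open>m\<close> can be replaced by \<open>l = p - 2 - m\<close>. For the smaller last digits,
  \<open>M(p n + r) \<equiv> T(n) M(r)\<close>, because \<open>trinom a b ^ r * (1 - X\<^sup>2)\<close> still has only exponents
  of absolute value less than \<open>p\<close>.
\<close>

unbundle fps_syntax

section \<open>Coefficients of powers of the trinomial\<close>

lemma trinom_power_Suc_nth: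
  "trinom a b ^ Suc n $$ j =
     int a * trinom a b ^ n $$ (j + 1) + int b * trinom a b ^ n $$ j + int a * trinom a b ^ n $$ (j - 1)"
proof -
  have "trinom a b ^ Suc n = of_nat a * (fls_X_inv * trinom a b ^ n) + of_nat b * trinom a b ^ n
      + of_nat a * (fls_X * trinom a b ^ n)"
    by (simp add: trinom_def algebra_simps)
  then show ?thesis
    by (simp add: fls_X_inv_times_conv_shift fls_X_times_conv_shift)
qed

text \<open>Reflects the invariance of \<open>trinom a b\<close> under exchanging X and 1/X.\<close>

lemma trinom_power_nth_minus: "trinom a b ^ n $$ (- j) = trinom a b ^ n $$ j"
proof (induction n arbitrary: j)
  case 0
  show ?case by (simp add: fls_one_nth)
next
  case (Suc n)
  have "trinom a b ^ n $$ (- j + 1) = trinom a b ^ n $$ (j - 1)"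
       "trinom a b ^ n $$ (- j - 1) = trinom a b ^ n $$ (j + 1)"
    using Suc.IH[of "j - 1"] Suc.IH[of "j + 1"] by simp_all
  then show ?case
    unfolding trinom_power_Suc_nth Suc.IH by simp
qed

lemma trinom_power_nth_eq_0: "int n < \<bar>j\<bar> \<Longrightarrow> trinom a b ^ n $$ j = 0"
proof (induction n arbitrary: j)
  case 0
  then show ?case by (simp add: fls_one_nth)
next
  case (Suc n)
  then show ?case unfolding trinom_power_Suc_nth by simp
qed

lemma trinom_power_times_nth:
  "(trinom a b ^ n * (1 - fls_X ^ 2)) $$ j = trinom a b ^ n $$ j - trinom a b ^ n $$ (j - 2)"
  by (simp add: right_diff_distrib fls_X_power_times_conv_shift)

lemma T_conv_nth: "T a b n = trinom a b ^ n $$ 0"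
  by (simp add: T_def ct_def)

lemma M_conv_nth: "M a b n = trinom a b ^ n $$ 0 - trinom a b ^ n $$ 2"
  using trinom_power_nth_minus[of a b n 2] by (simp add: M_def ct_def trinom_power_times_nth)

lemma T_0 [simp]: "T a b 0 = 1" and T_1 [simp]: "T a b (Suc 0) = int b"
  unfolding T_conv_nth trinom_power_Suc_nth by (simp_all add: fls_one_nth)

lemma trinom_power_Suc_nth_1: "trinom a b ^ Suc n $$ 1 = int (Suc n) * (int a * M a b n)"
proof -
  \<comment> \<open>Both sides are the coefficient of \<open>X ^ (j - 1)\<close> in the derivative of \<open>trinom a b ^ (n + 1)\<close>.\<close>
  have "j * trinom a b ^ Suc n $$ j
      = int (Suc n) * (int a * (trinom a b ^ n $$ (j - 1) - trinom a b ^ n $$ (j + 1)))" for j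
  proof (induction n arbitrary: j)
    case 0
    have "j + 1 = 0 \<longleftrightarrow> j = - 1" "j - 1 = 0 \<longleftrightarrow> j = 1" by auto
    then show ?case unfolding trinom_power_Suc_nth by (auto simp: fls_one_nth)
  next
    case (Suc n)
    let ?P = "trinom a b"
    have "j * ?P ^ Suc (Suc n) $$ j = int a * ((j + 1) * ?P ^ Suc n $$ (j + 1))
       + int b * (j * ?P ^ Suc n $$ j) + int a * ((j - 1) * ?P ^ Suc n $$ (j - 1))
       + int a * (?P ^ Suc n $$ (j - 1) - ?P ^ Suc n $$ (j + 1))"
      unfolding trinom_power_Suc_nth[of a b "Suc n"] by (simp add: algebra_simps)
    also have "int a * ((j + 1) * ?P ^ Suc n $$ (j + 1))
       + int b * (j * ?P ^ Suc n $$ j) + int a * ((j - 1) * ?P ^ Suc n $$ (j - 1))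
       = int (Suc n) * (int a * (?P ^ Suc n $$ (j - 1) - ?P ^ Suc n $$ (j + 1)))"
      unfolding Suc.IH by (unfold trinom_power_Suc_nth) (simp add: algebra_simps)
    finally show ?case by (simp add: algebra_simps)
  qed
  from this[of 1] show ?thesis by (simp add: M_conv_nth)
qed

section \<open>Linear relations between \<open>M\<close> and \<open>T\<close>, and the recurrence
  for \<open>T\<close>\<close>

lemma T_Suc: "T a b (Suc n) = int b * T a b n + 2 * int a * trinom a b ^ n $$ 1"
  unfolding T_conv_nth trinom_power_Suc_nth
  using trinom_power_nth_minus[of a b n 1] by simp

lemma M_T_forward:
  "2 * (int a)^2 * (int (Suc n) * M a b n) = T a b (n + 2) - int b * T a b (n + 1)"
  using T_Suc[of a b "Suc n"] trinom_power_Suc_nth_1[of a b n]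
  by (simp add: algebra_simps power2_eq_square)

text \<open>The coefficient of X in \<open>trinom a b ^ Suc n\<close> is computed twice: by
  expanding one factor, and by \<open>trinom_power_Suc_nth_1\<close>. Multiplying by
  \<open>2 * int a\<close> lets \<open>T_Suc\<close> replace the remaining coefficient at index 1 by
  values of \<open>T\<close>.\<close>

lemma M_T_backward:
  "2 * (int a)^2 * (int (n + 2) * M a b n)
     = int b * T a b (n + 1) - ((int b)^2 - 4 * (int a)^2) * T a b n"
proof -
  have "int a * trinom a b ^ n $$ 2 + int b * trinom a b ^ n $$ 1 + int a * trinom a b ^ n $$ 0
      = int (Suc n) * (int a * M a b n)"
    using trinom_power_Suc_nth_1[of a b n] trinom_power_Suc_nth[of a b n 1] by simp
  then have "int (n + 2) * (int a * M a b n) = 2 * int a * T a b n + int b * trinom a b ^ n $$ 1"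
    by (simp add: M_conv_nth T_conv_nth algebra_simps)
  then have "2 * int a * (int (n + 2) * (int a * M a b n))
      = 2 * int a * (2 * int a * T a b n + int b * trinom a b ^ n $$ 1)"
    by simp
  then show ?thesis
    using T_Suc[of a b n] by (simp add: algebra_simps power2_eq_square)
qed

lemma T_recurrence:
  "int (n + 2) * T a b (n + 2) = int b * int (2 * n + 3) * T a b (n + 1)
     - int (n + 1) * ((int b)^2 - 4 * (int a)^2) * T a b n"
proof -
  \<comment> \<open>\<open>M\<close> is eliminated by taking \<open>n + 2\<close> times the forward
    relation and \<open>n + 1\<close> times the backward one.\<close>
  have "int (n + 2) * (T a b (n + 2) - int b * T a b (n + 1))
      = int (n + 1) * (int b * T a b (n + 1) - ((int b)^2 - 4 * (int a)^2) * T a b n)"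
    unfolding M_T_forward[symmetric] M_T_backward[symmetric] by (simp add: mult_ac)
  then show ?thesis by (simp add: algebra_simps)
qed

section \<open>Lucas congruences for \<open>T\<close> and \<open>M\<close>\<close>

lemma prime_dvd_freshmans_dream_diff:
  fixes x y :: "'a::comm_ring_1"
  assumes "prime p"
  shows "of_nat p dvd (x + y) ^ p - (x ^ p + y ^ p)"
proof -
  have p: "0 < p" using assms by (simp add: prime_gt_0_nat)
  have "(x + y) ^ p = (\<Sum>k\<le>p. of_nat (p choose k) * x ^ k * y ^ (p - k))"
    by (rule binomial_ring)
  also have "{..p} = insert 0 (insert p {0<..<p})" using p by auto
  finally have "(x + y) ^ p - (x ^ p + y ^ p)
      = (\<Sum>k\<in>{0<..<p}. of_nat (p choose k) * x ^ k * y ^ (p - k))"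
    using p by simp
  also have "of_nat p dvd \<dots>"
  proof (intro dvd_sum dvd_mult2)
    fix k assume "k \<in> {0<..<p}"
    then have "p dvd p choose k" using assms by (intro dvd_choose_prime) auto
    then show "of_nat p dvd (of_nat (p choose k) :: 'a)" by (metis dvdE dvd_triv_left of_nat_mult)
  qed
  finally show ?thesis .
qed

text \<open>Fermat's little theorem for the images of naturals in any commutative ring, by induction
  with the freshman's dream. It handles the coefficients \<open>a\<close> and \<open>b\<close> as
  elements of \<open>int fls\<close>.\<close>

lemma prime_dvd_of_nat_power_diff:
  assumes "prime p"
  shows "of_nat p dvd (of_nat a :: 'a::comm_ring_1) ^ p - of_nat a"
proof (induction a)
  case 0
  show ?case using assms by (simp add: power_0_left prime_gt_0_nat)
next
  case (Suc a)
  have "of_nat p dvd ((1 + of_nat a :: 'a) ^ p - (1 ^ p + of_nat a ^ p)) + (of_nat a ^ p - of_nat a)"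
    using prime_dvd_freshmans_dream_diff[OF assms] Suc.IH by (rule dvd_add)
  then show ?case by (simp add: algebra_simps)
qed

lemma fls_compose_power_of_nat [simp]:
  "d > 0 \<Longrightarrow> fls_compose_power (of_nat n) d = of_nat n"
  by (simp add: fls_of_nat)

lemma trinom_power_prime:
  assumes "prime p"
  shows "of_nat p dvd trinom a b ^ p - fls_compose_power (trinom a b) p"
proof -
  have p: "0 < p" using assms by (simp add: prime_gt_0_nat)
  define u v w :: "int fls" where
    "u = of_nat a * fls_X_inv" and "v = of_nat b" and "w = of_nat a * fls_X"
  \<comment> \<open>The difference splits into two freshman's-dream errors, one per addition, and
    three Fermat errors, one per coefficient.\<close>
  have "trinom a b ^ p - fls_compose_power (trinom a b) p
      = ((u + v + w) ^ p - ((u + v) ^ p + w ^ p)) + ((u + v) ^ p - (u ^ p + v ^ p))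
        + ((of_nat a ^ p - of_nat a) * fls_X_inv ^ p + (of_nat b ^ p - of_nat b)
        + (of_nat a ^ p - of_nat a) * fls_X ^ p)"
    using p by (simp add: trinom_def u_def v_def w_def power_mult_distrib algebra_simps
        fls_X_power_conv_shift_1 fls_X_inv_power_conv_shift_1)
  also have "of_nat p dvd \<dots>"
    by (intro dvd_add dvd_mult2 prime_dvd_freshmans_dream_diff prime_dvd_of_nat_power_diff assms)
  finally show ?thesis .
qed

text \<open>The series f(X^d) has only exponents divisible by d, while those of g are smaller than d
  in absolute value. Opposite exponents can therefore meet only at 0.\<close>

lemma fls_compose_power_times_nth_0:
  fixes f g :: "'a::semiring_0 fls"
  assumes "d > 0" and "\<And>j. int d \<le> \<bar>j\<bar> \<Longrightarrow> g $$ j = 0"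
  shows "(fls_compose_power f d * g) $$ 0 = f $$ 0 * g $$ 0"
proof -
  let ?f = "fls_compose_power f d"
  define S where "S = {fls_subdegree ?f..0 - fls_subdegree g}"
  have "?f $$ i * g $$ (0 - i) = 0" if "i \<noteq> 0" for i
  proof (cases "int d dvd i")
    case True
    then have "int d \<le> \<bar>- i\<bar>" using that dvd_imp_le_int[of i "int d"] by simp
    then show ?thesis using assms(2)[of "- i"] by simp
  next
    case False
    then show ?thesis using assms(1) by (simp add: fls_nth_compose_power)
  qed
  then have "(?f * g) $$ 0 = (\<Sum>i\<in>S. if i = 0 then ?f $$ 0 * g $$ 0 else 0)"
    unfolding fls_times_nth(2) S_def by (intro sum.cong) auto
  also have "\<dots> = (if 0 \<in> S then ?f $$ 0 * g $$ 0 else 0)"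
    by (simp add: S_def)
  \<comment> \<open>If 0 lies outside \<open>S\<close>, one of the two subdegrees is positive, so
    that factor already has constant coefficient 0.\<close>
  also have "\<dots> = ?f $$ 0 * g $$ 0"
    by (auto simp: S_def not_le)
  also have "?f $$ 0 = f $$ 0" using assms(1) by (simp add: fls_nth_compose_power)
  finally show ?thesis .
qed

lemma ct_cong_of_dvd:
  assumes "of_nat p dvd f - g"
  shows "[ct f = ct g] (mod int p)"
proof -
  from assms obtain h where "f - g = of_nat p * h" by (elim dvdE)
  then have "(f - g) $$ 0 = (of_nat p * h) $$ 0" by simp
  then have "ct f - ct g = int p * h $$ 0" by (simp add: ct_def)
  then show ?thesis by (simp add: cong_iff_dvd_diff)
qed

text \<open>Modulo p, the power \<open>trinom a b ^ (p * n)\<close> is the n-th power of the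
  trinomial with X replaced by X^p, and the constant term of its product with a short series
  factors. Taking g = 1 serves \<open>T\<close>, and g = 1 - X^2 serves \<open>M\<close>.\<close>

lemma ct_trinom_power_lucas:
  assumes "prime p" and "\<And>j. int p \<le> \<bar>j\<bar> \<Longrightarrow> (trinom a b ^ r * g) $$ j = 0"
  shows "[ct (trinom a b ^ (p * n + r) * g) = T a b n * ct (trinom a b ^ r * g)] (mod int p)"
proof -
  let ?P = "trinom a b"
  have p: "0 < p" using assms by (simp add: prime_gt_0_nat)
  \<comment> \<open>This is the divisibility of x^n - y^n by x - y.\<close>
  have "?P ^ p - fls_compose_power ?P p dvd (?P ^ p) ^ n - fls_compose_power ?P p ^ n"
    unfolding power_diff_sumr2[of "?P ^ p"] by (rule dvd_triv_left)
  then have "of_nat p dvd ((?P ^ p) ^ n - fls_compose_power ?P p ^ n) * (?P ^ r * g)"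
    using trinom_power_prime[OF assms(1)] dvd_trans by (intro dvd_mult2) blast
  then have "of_nat p dvd ?P ^ (p * n + r) * g - fls_compose_power (?P ^ n) p * (?P ^ r * g)"
    using p by (simp add: power_add power_mult left_diff_distrib mult.assoc)
  from ct_cong_of_dvd[OF this] show ?thesis
    using fls_compose_power_times_nth_0[OF p assms(2), of "?P ^ n"]
    by (simp add: ct_def T_def)
qed

lemma T_lucas:
  assumes "prime p" "r < p"
  shows "[T a b (p * n + r) = T a b n * T a b r] (mod int p)"
  using ct_trinom_power_lucas[of p a b r 1 n] assms by (simp add: T_def trinom_power_nth_eq_0)

lemma M_lucas:
  assumes "prime p" "r + 2 < p"
  shows "[M a b (p * n + r) = T a b n * M a b r] (mod int p)"
  unfolding M_def using assms(2)
  by (intro ct_trinom_power_lucas[OF assms(1)])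
     (simp add: trinom_power_times_nth trinom_power_nth_eq_0)

text \<open>Each appended digit 0 contributes the factor \<open>T a b 0 = 1\<close>.\<close>

lemma T_power_times:
  assumes "prime p"
  shows "[T a b (p ^ k * n) = T a b n] (mod int p)"
proof (induction k)
  case (Suc k)
  have "[T a b (p * (p ^ k * n) + 0) = T a b (p ^ k * n) * T a b 0] (mod int p)"
    using assms by (intro T_lucas) (simp_all add: prime_gt_0_nat)
  then show ?case using cong_trans[OF _ Suc.IH] by (simp add: mult.assoc)
qed simp

lemma T_not_cong_0:
  assumes "prime p" and nz: "\<forall>j<p. \<not> [T a b j = 0] (mod int p)"
  shows "\<not> [T a b n = 0] (mod int p)"
proof (induction n rule: less_induct)
  case (less n)
  have p: "1 < p" using assms(1) by (rule prime_gt_1_nat)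
  show ?case
  proof (cases "n < p")
    case False
    have "[T a b n = T a b (n div p) * T a b (n mod p)] (mod int p)"
      using T_lucas[OF assms(1), of "n mod p" a b "n div p"] p by simp
    moreover have "\<not> [T a b (n div p) = 0] (mod int p)" using less False p by simp
    moreover have "\<not> [T a b (n mod p) = 0] (mod int p)" using nz p by simp
    ultimately show ?thesis
      using assms(1) by (metis cong_0_iff cong_dvd_iff prime_dvd_multD prime_nat_int_transfer)
  qed (use nz in simp)
qed

section \<open>Reflection of \<open>T\<close> modulo p\<close>

text \<open>Modulo \<open>p\<close>, both sides solve the recurrence of lemma \<open>T_recurrence\<close>, because
  the substitution \<open>n \<mapsto> p - 3 - n\<close> reverses it.\<close>

lemma T_reflection:
  fixes a b :: nat
  defines "D \<equiv> (int b)^2 - 4 * (int a)^2"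
  assumes "prime p" "n < p"
  shows "[D ^ n * T a b (p - 1 - n) = T a b (p - 1) * T a b n] (mod int p)"
proof -
  let ?R = "\<lambda>n. int p dvd D ^ n * T a b (p - 1 - n) - T a b (p - 1) * T a b n"
  have p: "1 < p" using assms(2) by (rule prime_gt_1_nat)
  \<comment> \<open>Two consecutive instances are carried along, since the recurrence has order
    two.\<close>
  have "n < p \<longrightarrow> ?R n" "Suc n < p \<longrightarrow> ?R (Suc n)"
  proof (induction n)
    case 0
    show "0 < p \<longrightarrow> ?R 0" by simp
    define r where "r = p - 2"
    then have r: "p = Suc (Suc r)" using p by simp
    \<comment> \<open>For \<open>r = p - 2\<close> the coefficients \<open>r + 2\<close>,
      \<open>2 * r + 3\<close>, \<open>r + 1\<close> are p, 2p - 1, p - 1, hence 0, -1, -1 modulo p.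
      The second base case then follows from \<open>T a b 1 = b\<close>.\<close>
    have "D * T a b r - int b * T a b (Suc r)
        = int p * (T a b (Suc (Suc r)) - 2 * int b * T a b (Suc r) + D * T a b r)"
      using T_recurrence[of r a b] unfolding D_def r by (simp add: algebra_simps)
    then show "Suc 0 < p \<longrightarrow> ?R (Suc 0)" using r by (simp add: mult.commute)
  next
    case (Suc n)
    show "Suc n < p \<longrightarrow> ?R (Suc n)" by (rule Suc.IH(2))
    show "Suc (Suc n) < p \<longrightarrow> ?R (Suc (Suc n))"
    proof
      assume less: "Suc (Suc n) < p"
      define N where "N = p - (n + 3)"
      then have N: "p = N + n + 3" using less by simp
      define A B C where "A = T a b (N + 2)" and "B = T a b (N + 1)" and "C = T a b N"
      define e where "e = T a b (p - 1)"
      have "?R n" "?R (Suc n)" using Suc.IH less by simp_all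
      then obtain s t where s: "D ^ n * A = e * T a b n + int p * s"
        and t: "D ^ Suc n * B = e * T a b (n + 1) + int p * t"
        by (auto simp: N A_def B_def e_def algebra_simps elim!: dvdE)
      \<comment> \<open>Modulo p, the coefficients \<open>N + 2\<close>, \<open>2 * N + 3\<close>,
        \<open>N + 1\<close> are the negatives of \<open>n + 1\<close>, \<open>2 * n + 3\<close>,
        \<open>n + 2\<close>. The recurrence at \<open>N\<close> thus determines \<open>C\<close>
        from \<open>B\<close> and \<open>A\<close>, and the multiples of p left over are kept
        explicitly.\<close>
      have "int (n + 2) * D * C = int b * int (2 * n + 3) * B - int (n + 1) * A
          + int p * (A - 2 * int b * B + D * C)"
        using T_recurrence[of N a b] unfolding N D_def[symmetric] A_def B_def C_def
        by (simp add: algebra_simps)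
      then have "D ^ Suc n * (int (n + 2) * D * C)
        = D ^ Suc n * (int b * int (2 * n + 3) * B - int (n + 1) * A
          + int p * (A - 2 * int b * B + D * C))"
        by simp
      then have "int (n + 2) * (D ^ Suc (Suc n) * C)
        = int b * int (2 * n + 3) * (D ^ Suc n * B) - int (n + 1) * D * (D ^ n * A)
          + int p * (D ^ Suc n * (A - 2 * int b * B + D * C))"
        by (simp add: algebra_simps)
      also have "\<dots> = int (n + 2) * (e * T a b (n + 2))
         + int p * (int b * int (2 * n + 3) * t - int (n + 1) * D * s
           + D ^ Suc n * (A - 2 * int b * B + D * C))"
      proof -
        have "int (n + 2) * (e * T a b (n + 2)) = e * (int b * int (2 * n + 3) * T a b (n + 1)
           - int (n + 1) * D * T a b n)"
          using T_recurrence[of n a b] by (simp add: D_def mult.left_commute)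
        then show ?thesis unfolding s t by (simp add: algebra_simps)
      qed
      finally have "int (n + 2) * (D ^ Suc (Suc n) * C - e * T a b (n + 2))
         = int p * (int b * int (2 * n + 3) * t - int (n + 1) * D * s
           + D ^ Suc n * (A - 2 * int b * B + D * C))"
        by (simp add: algebra_simps)
      then have "int p dvd int (n + 2) * (D ^ Suc (Suc n) * C - e * T a b (n + 2))"
        by simp
      moreover have "\<not> int p dvd int (n + 2)"
        unfolding int_dvd_int_iff using less by (intro nat_dvd_not_less) simp_all
      ultimately have "int p dvd D ^ Suc (Suc n) * C - e * T a b (n + 2)"
        using assms(2) prime_dvd_mult_iff[of "int p"] by auto
      then show "?R (Suc (Suc n))" by (simp add: N C_def e_def)
    qed
  qed
  then show ?thesis using assms(3) by (simp add: cong_iff_dvd_diff)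
qed

text \<open>Reflection at the index p - 1 gives \<open>D ^ (p - 1) * T a b 0\<close> for the square,
  and Fermat's little theorem evaluates the power of the discriminant.\<close>

lemma T_prime_minus_1_square:
  assumes "prime p" "\<not> int p dvd (int b)^2 - 4 * (int a)^2"
  shows "[T a b (p - 1) * T a b (p - 1) = 1] (mod int p)"
proof -
  let ?D = "(int b)^2 - 4 * (int a)^2"
  have "coprime ?D (int p)"
    using assms by (metis coprime_commute prime_imp_coprime prime_nat_int_transfer)
  moreover have "residues (int p)"
    using assms(1) by unfold_locales (simp add: prime_gt_1_nat prime_gt_Suc_0_nat)
  ultimately have "[?D ^ totient p = 1] (mod int p)"
    using residues.euler_theorem[of "int p" ?D] by simp
  then have "[?D ^ (p - 1) = 1] (mod int p)"
    using assms(1) by (simp add: totient_prime)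
  moreover have "[?D ^ (p - 1) * T a b (p - 1 - (p - 1)) = T a b (p - 1) * T a b (p - 1)] (mod int p)"
    using assms(1) by (intro T_reflection) (auto simp: prime_gt_0_nat)
  ultimately show ?thesis by (simp add: cong_def)
qed

section \<open>Vanishing of \<open>M\<close> expressed through \<open>T\<close>\<close>

lemma cong_mult_cancel_prime:
  fixes u x y :: int
  assumes "prime p" "\<not> [u = 0] (mod int p)"
  shows "[u * x = u * y] (mod int p) \<longleftrightarrow> [x = y] (mod int p)"
  using assms by (metis cong_0_iff cong_mult_lcancel coprime_commute prime_imp_coprime prime_nat_int_transfer)

lemma cong_eq_cong_cong:
  fixes x y :: int
  shows "[x = x'] (mod m) \<Longrightarrow> [y = y'] (mod m) \<Longrightarrow> [x = y] (mod m) \<longleftrightarrow> [x' = y'] (mod m)"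
  by (simp add: cong_def)

text \<open>The factor \<open>2 * a ^ 2 * (n + 1)\<close> in \<open>M_T_forward\<close> is a unit
  modulo p. This version serves last digit p - 2, where \<open>n + 1\<close> ends in p - 1.\<close>

lemma M_cong_0_iff_forward:
  assumes "prime p" "p > 2" "\<not> p dvd a" "\<not> p dvd n + 1"
  shows "[M a b n = 0] (mod int p) \<longleftrightarrow> [T a b (n + 2) = int b * T a b (n + 1)] (mod int p)"
proof -
  have "\<not> p dvd 2" using assms(2) by (simp add: nat_dvd_not_less)
  then have "\<not> p dvd 2 * a ^ 2 * (n + 1)"
    using assms unfolding prime_dvd_mult_iff[OF assms(1)] by (auto dest: prime_dvd_power)
  then have "\<not> [int (2 * a ^ 2 * (n + 1)) = 0] (mod int p)"
    by (simp only: cong_0_iff int_dvd_int_iff not_False_eq_True)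
  from cong_mult_cancel_prime[OF assms(1) this, of "M a b n" 0] show ?thesis
    unfolding cong_iff_dvd_diff M_T_forward[symmetric] by (simp add: algebra_simps)
qed

text \<open>This version serves last digit p - 1, where p divides \<open>n + 1\<close> and the
  forward criterion does not apply.\<close>

lemma M_cong_0_iff_backward:
  assumes "prime p" "p > 2" "\<not> p dvd a" "\<not> p dvd n + 2"
  shows "[M a b n = 0] (mod int p)
    \<longleftrightarrow> [int b * T a b (n + 1) = ((int b)^2 - 4 * (int a)^2) * T a b n] (mod int p)"
proof -
  have "\<not> p dvd 2" using assms(2) by (simp add: nat_dvd_not_less)
  then have "\<not> p dvd 2 * a ^ 2 * (n + 2)"
    using assms unfolding prime_dvd_mult_iff[OF assms(1)] by (auto dest: prime_dvd_power)
  then have "\<not> [int (2 * a ^ 2 * (n + 2)) = 0] (mod int p)"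
    by (simp only: cong_0_iff int_dvd_int_iff not_False_eq_True)
  from cong_mult_cancel_prime[OF assms(1) this, of "M a b n" 0] show ?thesis
    unfolding cong_iff_dvd_diff M_T_backward[symmetric] by (simp add: algebra_simps)
qed

section \<open>Digit words and the three cases for the last digit\<close>

lemma horner_sum_rev_snoc:
  "horner_sum id p (rev (w @ [d])) = p * horner_sum id p (rev w) + (d :: nat)"
  by simp

text \<open>Adding 1 carries through the trailing digits p - 1, turning them into zeros and
  \<open>m\<close> into \<open>m + 1\<close>. Without the addition, each of these digits contributes
  a factor \<open>T a b (p - 1)\<close> by the Lucas congruence.\<close>

lemma word_trailing_max_digits:
  fixes p m :: nat and q :: "nat list"
  defines "v \<equiv> horner_sum id p (rev q)"
    and "N \<equiv> \<lambda>k. horner_sum id p (rev (q @ [m] @ replicate k (p - 1)))"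
  assumes "prime p" "m < p"
  shows Suc_word_trailing_max_digits: "N k + 1 = p ^ k * (p * v + (m + 1))"
    and T_word_trailing_max_digits: "[T a b (N k) = T a b v * T a b m * T a b (p - 1) ^ k] (mod int p)"
proof -
  have p: "0 < p" using assms by (simp add: prime_gt_0_nat)
  have N_0: "N 0 = p * v + m" by (simp add: N_def v_def)
  have N_Suc: "N (Suc k) = p * N k + (p - 1)" for k
    unfolding N_def horner_sum_rev_snoc[symmetric] by (simp add: replicate_append_same)
  show "N k + 1 = p ^ k * (p * v + (m + 1))"
  proof (induction k)
    case (Suc k)
    have "N (Suc k) + 1 = p * (N k + 1)" using p by (simp add: N_Suc)
    then show ?case by (simp only: Suc.IH power_Suc mult.assoc)
  qed (simp add: N_0)
  show "[T a b (N k) = T a b v * T a b m * T a b (p - 1) ^ k] (mod int p)"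
  proof (induction k)
    case 0
    show ?case using T_lucas[OF assms(3,4)] by (simp add: N_0)
  next
    case (Suc k)
    have "[T a b (N (Suc k)) = T a b (N k) * T a b (p - 1)] (mod int p)"
      unfolding N_Suc using p by (intro T_lucas assms) simp
    also have "[T a b (N k) * T a b (p - 1)
        = T a b v * T a b m * T a b (p - 1) ^ k * T a b (p - 1)] (mod int p)"
      by (intro cong_mult Suc.IH cong_refl)
    finally show ?case by (simp add: mult_ac)
  qed
qed

lemma M_cong_0_iff_last_digit_small:
  assumes "prime p" "\<forall>j<p. \<not> [T a b j = 0] (mod int p)" "base_word p n (q @ [r])" "r < p - 2"
  shows "[M a b n = 0] (mod int p) \<longleftrightarrow> [M a b r = 0] (mod int p)"
proof -
  define v where "v = horner_sum id p (rev q)"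
  have n: "n = p * v + r" using assms(3) by (simp add: base_word_def v_def)
  have "[M a b n = T a b v * M a b r] (mod int p)"
    unfolding n using assms(4) by (intro M_lucas[OF assms(1)]) simp
  then have "[M a b n = 0] (mod int p) \<longleftrightarrow> [T a b v * M a b r = T a b v * 0] (mod int p)"
    by (simp add: cong_def)
  also have "\<dots> \<longleftrightarrow> [M a b r = 0] (mod int p)"
    by (intro cong_mult_cancel_prime T_not_cong_0 assms)
  finally show ?thesis .
qed

lemma M_cong_0_iff_last_digit_p_minus_2:
  assumes "prime p" "p > 2" "\<not> int p dvd (int b)^2 - 4 * (int a)^2"
    and "\<forall>j<p. \<not> [T a b j = 0] (mod int p)" "\<not> p dvd a"
    and "base_word p n (q @ [m] @ replicate k (p - 1) @ [p - 2])" "m < p - 1"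
  shows "[M a b n = 0] (mod int p) \<longleftrightarrow>
    [int b * T a b m = T a b (p - 1) ^ (k + 1) * T a b (m + 1)] (mod int p)"
proof -
  define v where "v = horner_sum id p (rev q)"
  define e where "e = T a b (p - 1)"
  define N where "N = horner_sum id p (rev (q @ [m] @ replicate k (p - 1)))"
  have m: "m < p" using assms(7) by simp
  have p: "0 < p" using assms(2) by simp
  have N1: "N + 1 = p ^ k * (p * v + (m + 1))"
    unfolding N_def v_def by (intro Suc_word_trailing_max_digits assms m)
  have n: "n = p * N + (p - 2)"
    using assms(6) unfolding base_word_def N_def horner_sum_rev_snoc[symmetric] by simp
  \<comment> \<open>Adding 2 turns the last digit p - 2 into 0 and carries into
    \<open>N\<close>.\<close>
  have "n + 2 = p * (N + 1)" using n assms(2) by simp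
  then have n2: "n + 2 = p ^ (k + 1) * (p * v + (m + 1))" by (simp only: N1 power_add power_one_right mult_ac)
  have n1: "n + 1 = p * N + (p - 1)" using n assms(2) by simp
  have "\<not> p dvd n + 1"
    unfolding n1 dvd_add_right_iff[OF dvd_triv_left] using assms(2) by (intro nat_dvd_not_less) auto
  then have "[M a b n = 0] (mod int p) \<longleftrightarrow> [T a b (n + 2) = int b * T a b (n + 1)] (mod int p)"
    by (intro M_cong_0_iff_forward assms)
  moreover have "[T a b (n + 2) = T a b v * T a b (m + 1)] (mod int p)"
    unfolding n2 by (rule cong_trans[OF T_power_times T_lucas]) (use assms in auto)
  moreover have "[T a b (n + 1) = T a b v * T a b m * e ^ k * e] (mod int p)"
    unfolding n1 e_def N_def v_def
    by (rule cong_trans[OF T_lucas cong_mult[OF T_word_trailing_max_digits cong_refl]])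
       (use assms m p in auto)
  ultimately have "[M a b n = 0] (mod int p) \<longleftrightarrow>
      [T a b v * T a b (m + 1) = int b * (T a b v * T a b m * e ^ k * e)] (mod int p)"
    using cong_eq_cong_cong cong_scalar_left by blast
  also have "\<dots> \<longleftrightarrow> [T a b v * T a b (m + 1) = T a b v * (e ^ (k + 1) * (int b * T a b m))] (mod int p)"
    by (simp add: mult_ac)
  also have "\<dots> \<longleftrightarrow> [T a b (m + 1) = e ^ (k + 1) * (int b * T a b m)] (mod int p)"
    by (intro cong_mult_cancel_prime T_not_cong_0 assms)
  \<comment> \<open>Multiplying by the unit \<open>e ^ (k + 1)\<close> moves that power to the other
    side, because \<open>e * e\<close> is 1 modulo p.\<close>
  also have "\<dots> \<longleftrightarrow> [e ^ (k + 1) * T a b (m + 1)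
      = e ^ (k + 1) * (e ^ (k + 1) * (int b * T a b m))] (mod int p)"
  proof (intro cong_mult_cancel_prime[symmetric] assms)
    have "\<not> int p dvd e" using assms(4) p by (simp add: e_def cong_0_iff)
    then show "\<not> [e ^ (k + 1) = 0] (mod int p)"
      using assms(1) prime_dvd_power[of "int p" e "k + 1"] by (auto simp: cong_0_iff)
  qed
  also have "\<dots> \<longleftrightarrow> [int b * T a b m = e ^ (k + 1) * T a b (m + 1)] (mod int p)"
  proof -
    have "[(e * e) ^ (k + 1) * (int b * T a b m) = 1 ^ (k + 1) * (int b * T a b m)] (mod int p)"
      unfolding e_def by (intro cong_mult cong_pow cong_refl T_prime_minus_1_square assms)
    then have "[e ^ (k + 1) * (e ^ (k + 1) * (int b * T a b m)) = int b * T a b m] (mod int p)"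
      by (simp only: power_mult_distrib power_one mult_1 mult.assoc)
    then show ?thesis by (auto simp: cong_def)
  qed
  finally show ?thesis unfolding e_def .
qed

lemma M_cong_0_iff_last_digit_p_minus_1:
  assumes "prime p" "p > 2" "\<not> int p dvd (int b)^2 - 4 * (int a)^2"
    and "\<forall>j<p. \<not> [T a b j = 0] (mod int p)" "\<not> p dvd a"
    and "base_word p n (q @ [m] @ replicate k (p - 1) @ [p - 1])" "m < p - 1" "l = p - 2 - m"
  shows "[M a b n = 0] (mod int p) \<longleftrightarrow>
    [int b * T a b l = T a b (p - 1) ^ (k + 1) * T a b (l + 1)] (mod int p)"
proof -
  define v where "v = horner_sum id p (rev q)"
  define e where "e = T a b (p - 1)"
  define D where "D = (int b)^2 - 4 * (int a)^2"
  have m: "m < p" using assms(7) by simp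
  have p: "0 < p" using assms(2) by simp
  \<comment> \<open>The last digit joins the \<open>k\<close> equal digits before it, which is the
    source of the exponent \<open>k + 1\<close>.\<close>
  have word: "replicate k (p - 1) @ [p - 1] = replicate (k + 1) (p - 1)"
    by (simp add: replicate_append_same)
  have n: "n = horner_sum id p (rev (q @ [m] @ replicate (k + 1) (p - 1)))"
    using assms(6) unfolding base_word_def word by simp
  have n1: "n + 1 = p ^ (k + 1) * (p * v + (m + 1))"
    unfolding n v_def by (intro Suc_word_trailing_max_digits assms m)
  then have "p dvd n + 1" by simp
  then have "\<not> p dvd (n + 1) + 1" using assms(2) by (simp only: dvd_add_right_iff) simp
  then have "[M a b n = 0] (mod int p) \<longleftrightarrow> [int b * T a b (n + 1) = D * T a b n] (mod int p)"
    unfolding D_def by (intro M_cong_0_iff_backward assms) simp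
  moreover have "[T a b (n + 1) = T a b v * T a b (m + 1)] (mod int p)"
    unfolding n1 by (rule cong_trans[OF T_power_times T_lucas]) (use assms in auto)
  moreover have "[T a b n = T a b v * T a b m * e ^ (k + 1)] (mod int p)"
    unfolding n e_def v_def by (intro T_word_trailing_max_digits assms m)
  ultimately have "[M a b n = 0] (mod int p) \<longleftrightarrow>
      [int b * (T a b v * T a b (m + 1)) = D * (T a b v * T a b m * e ^ (k + 1))] (mod int p)"
    using cong_eq_cong_cong cong_scalar_left by blast
  \<comment> \<open>The unit \<open>D ^ l\<close> is inserted to prepare for reflection: it
    accompanies T(m + 1), while T(m) receives \<open>D ^ (l + 1)\<close> thanks to the
    \<open>D\<close> already present.\<close>
  also have "\<dots> \<longleftrightarrow> [(T a b v * D ^ l) * (int b * T a b (m + 1))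
      = (T a b v * D ^ l) * (D * T a b m * e ^ (k + 1))] (mod int p)"
  proof -
    have D: "\<not> [D ^ l = 0] (mod int p)"
      using assms(1,3) by (auto simp: D_def cong_0_iff dest!: prime_dvd_power_int[rotated])
    show ?thesis
      using cong_mult_cancel_prime[OF assms(1) D,
          of "int b * (T a b v * T a b (m + 1))" "D * (T a b v * T a b m * e ^ (k + 1))"]
      by (simp only: mult_ac)
  qed
  also have "\<dots> \<longleftrightarrow> [T a b v * (int b * (D ^ l * T a b (m + 1)))
      = T a b v * (e ^ (k + 1) * (D ^ (l + 1) * T a b m))] (mod int p)"
    by (simp add: mult_ac)
  also have "\<dots> \<longleftrightarrow> [int b * (D ^ l * T a b (m + 1)) = e ^ (k + 1) * (D ^ (l + 1) * T a b m)] (mod int p)"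
    by (intro cong_mult_cancel_prime T_not_cong_0 assms)
  also have "\<dots> \<longleftrightarrow> [int b * (e * T a b l) = e ^ (k + 1) * (e * T a b (l + 1))] (mod int p)"
  proof -
    \<comment> \<open>Since \<open>l = p - 2 - m\<close>, reflection exchanges the index
      \<open>l\<close> with \<open>m + 1\<close> and \<open>l + 1\<close> with
      \<open>m\<close>.\<close>
    have ml: "p - 1 - l = m + 1" "p - 1 - (l + 1) = m" using assms(7,8) by simp_all
    have "[D ^ l * T a b (m + 1) = e * T a b l] (mod int p)"
      using T_reflection[of p l b a] assms(1,7,8) unfolding D_def e_def ml by simp
    moreover have "[D ^ (l + 1) * T a b m = e * T a b (l + 1)] (mod int p)"
      using T_reflection[of p "l + 1" b a] assms(1,7,8) unfolding D_def e_def ml by simp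
    ultimately show ?thesis by (intro cong_eq_cong_cong cong_scalar_left)
  qed
  also have "\<dots> \<longleftrightarrow> [e * (int b * T a b l) = e * (e ^ (k + 1) * T a b (l + 1))] (mod int p)"
    by (simp only: mult_ac)
  also have "\<dots> \<longleftrightarrow> [int b * T a b l = e ^ (k + 1) * T a b (l + 1)] (mod int p)"
    unfolding e_def by (intro cong_mult_cancel_prime T_not_cong_0 assms)
  finally show ?thesis unfolding e_def .
qed

section \<open>Assembly of the cases and specialization to a = b = 1\<close>

lemma prime_dvd_minus_3_iff: "prime (p :: nat) \<Longrightarrow> int p dvd - 3 \<longleftrightarrow> p = 3"
proof -
  assume "prime p"
  then have "p dvd 3 \<longleftrightarrow> p = 3" by (intro primes_dvd_imp_eq iffI) auto
  then show ?thesis by (simp flip: int_dvd_int_iff)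
qed

theorem corollary10:
  shows
    "(\<forall>(a::nat) (b::nat) (p::nat) (n::nat).
        prime p \<and> p > 2 \<and> \<not> int p dvd (int b)^2 - 4 * (int a)^2 \<and>
        (\<forall>j<p. \<not> [T a b j = 0] (mod int p)) \<longrightarrow>
          (\<forall>q n0. base_word p n (q @ [n0]) \<and> n0 < p - 2 \<longrightarrow>
             ([M a b n = 0] (mod int p) \<longleftrightarrow> [M a b n0 = 0] (mod int p))) \<and>
          (\<forall>q m k. \<not> p dvd a \<and> base_word p n (q @ [m] @ replicate k (p - 1) @ [p - 2]) \<and> m < p - 1 \<longrightarrow>
             ([M a b n = 0] (mod int p) \<longleftrightarrow>
              [int b * T a b m = (T a b (p - 1))^(k + 1) * T a b (m + 1)] (mod int p))) \<and>
          (\<forall>q m k l. \<not> p dvd a \<and> base_word p n (q @ [m] @ replicate k (p - 1) @ [p - 1]) \<and> m < p - 1 \<and>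
             l = p - 2 - m \<longrightarrow>
             l < p - 1 \<and>
             ([M a b n = 0] (mod int p) \<longleftrightarrow>
              [int b * T a b l = (T a b (p - 1))^(k + 1) * T a b (l + 1)] (mod int p))))
     \<and>
     (\<forall>(p::nat) (n::nat).
        prime p \<and> p > 2 \<longrightarrow>
          (\<not> int p dvd -3 \<longleftrightarrow> p \<noteq> 3) \<and>
          (\<not> int p dvd -3 \<and> (\<forall>j<p. \<not> [T 1 1 j = 0] (mod int p)) \<longrightarrow>
            (\<forall>q n0. base_word p n (q @ [n0]) \<and> n0 < p - 2 \<longrightarrow>
               ([M 1 1 n = 0] (mod int p) \<longleftrightarrow> [M 1 1 n0 = 0] (mod int p))) \<and>
            (\<forall>q m k. base_word p n (q @ [m] @ replicate k (p - 1) @ [p - 2]) \<and> m < p - 1 \<longrightarrow>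
               ([M 1 1 n = 0] (mod int p) \<longleftrightarrow>
                [T 1 1 m = (T 1 1 (p - 1))^(k + 1) * T 1 1 (m + 1)] (mod int p))) \<and>
            (\<forall>q m k l. base_word p n (q @ [m] @ replicate k (p - 1) @ [p - 1]) \<and> m < p - 1 \<and>
               l = p - 2 - m \<longrightarrow>
               ([M 1 1 n = 0] (mod int p) \<longleftrightarrow>
                [T 1 1 l = (T 1 1 (p - 1))^(k + 1) * T 1 1 (l + 1)] (mod int p)))))"
proof (intro conjI)
  show "\<forall>(a::nat) (b::nat) (p::nat) (n::nat).
        prime p \<and> p > 2 \<and> \<not> int p dvd (int b)^2 - 4 * (int a)^2 \<and>
        (\<forall>j<p. \<not> [T a b j = 0] (mod int p)) \<longrightarrow>
          (\<forall>q n0. base_word p n (q @ [n0]) \<and> n0 < p - 2 \<longrightarrow>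
             ([M a b n = 0] (mod int p) \<longleftrightarrow> [M a b n0 = 0] (mod int p))) \<and>
          (\<forall>q m k. \<not> p dvd a \<and> base_word p n (q @ [m] @ replicate k (p - 1) @ [p - 2]) \<and> m < p - 1 \<longrightarrow>
             ([M a b n = 0] (mod int p) \<longleftrightarrow>
              [int b * T a b m = (T a b (p - 1))^(k + 1) * T a b (m + 1)] (mod int p))) \<and>
          (\<forall>q m k l. \<not> p dvd a \<and> base_word p n (q @ [m] @ replicate k (p - 1) @ [p - 1]) \<and> m < p - 1 \<and>
             l = p - 2 - m \<longrightarrow>
             l < p - 1 \<and>
             ([M a b n = 0] (mod int p) \<longleftrightarrow>
              [int b * T a b l = (T a b (p - 1))^(k + 1) * T a b (l + 1)] (mod int p)))"
    (is "\<forall>a b p n. ?general a b p n")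
  proof (intro allI impI conjI; elim conjE)
    fix p m l :: nat assume "p > 2" "l = p - 2 - m"
    then show "l < p - 1" by simp
  qed (rule M_cong_0_iff_last_digit_small M_cong_0_iff_last_digit_p_minus_2
      M_cong_0_iff_last_digit_p_minus_1; assumption)+
  then have general: "?general 1 1 p n" for p n by blast
  show "\<forall>(p::nat) (n::nat).
        prime p \<and> p > 2 \<longrightarrow>
          (\<not> int p dvd -3 \<longleftrightarrow> p \<noteq> 3) \<and>
          (\<not> int p dvd -3 \<and> (\<forall>j<p. \<not> [T 1 1 j = 0] (mod int p)) \<longrightarrow>
            (\<forall>q n0. base_word p n (q @ [n0]) \<and> n0 < p - 2 \<longrightarrow>
               ([M 1 1 n = 0] (mod int p) \<longleftrightarrow> [M 1 1 n0 = 0] (mod int p))) \<and>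
            (\<forall>q m k. base_word p n (q @ [m] @ replicate k (p - 1) @ [p - 2]) \<and> m < p - 1 \<longrightarrow>
               ([M 1 1 n = 0] (mod int p) \<longleftrightarrow>
                [T 1 1 m = (T 1 1 (p - 1))^(k + 1) * T 1 1 (m + 1)] (mod int p))) \<and>
            (\<forall>q m k l. base_word p n (q @ [m] @ replicate k (p - 1) @ [p - 1]) \<and> m < p - 1 \<and>
               l = p - 2 - m \<longrightarrow>
               ([M 1 1 n = 0] (mod int p) \<longleftrightarrow>
                [T 1 1 l = (T 1 1 (p - 1))^(k + 1) * T 1 1 (l + 1)] (mod int p))))"
    (is "\<forall>p n. _ \<longrightarrow> _ \<and> ?special p n")
  proof (intro allI impI)
    fix p n :: nat assume p: "prime p \<and> p > 2"
    \<comment> \<open>At a = b = 1 the discriminant is -3 and the factor \<open>b\<close> disappears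
      from the criteria.\<close>
    have D: "(int 1)^2 - 4 * (int 1)^2 = - 3" and b: "int 1 * x = x" for x by simp_all
    have "\<not> p dvd 1" using p by simp
    with p general[of p n, unfolded D b] prime_dvd_minus_3_iff[of p]
    show "(\<not> int p dvd -3 \<longleftrightarrow> p \<noteq> 3) \<and> ?special p n" by blast
  qed
qed

end
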